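(* Let $\mathbf g=(g_1,\dots,g_m)\in M^1(\mathbb R^n)\otimes\mathbb C^m$ generate a multi-window Gabor frame over $\Lambda_D$ with canonical dual $\boldsymbol\gamma$, and let $\alpha\in\mathbb C^m$. Let $f\in\mathcal C_{\Lambda_D}$, $\zeta\in\mathbb R^{2n}$ and $\lambda\in\Lambda_D$. If $v_\alpha=\sum_s\overline{\alpha_s}\mathcal Z_Dg_s(0,0)\neq0$, then $$B_\lambda^{(\zeta)}(f)=s_\lambda(\zeta)\,B_0^{(\zeta)}(f),\qquad s_\lambda(\zeta):=\chi_D(\lambda)e^{2\pi i\sigma(\lambda,\zeta)}.$$ Equivalently, for every $\mu\in\Lambda_D^\circ$, $$a_{\mu+\lambda}\bigl(\Phi_{\boldsymbol\gamma,\alpha}(\rho(\zeta)f)\bigr)=\chi_D(\lambda)e^{2\pi i\sigma(\lambda,\zeta)}e^{-\pi i\sigma(\lambda,\mu)}\,a_\mu\bigl(\Phi_{\boldsymbol\gamma,\alpha}(\rho(\zeta)f)\bigr)$$ (this coefficient identity holding for every $\alpha$).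
   Context: Conventions: inner products and the $M^\infty$–$M^1$ pairing $\langle\cdot,\cdot\rangle$ (extending the $L^2$ inner product) are linear in the first and conjugate-linear in the second variable. $\rho(x,\omega)=e^{-\pi i x\cdot\omega}M_\omega T_x$ with $(T_xf)(t)=f(t-x)$, $(M_\omega f)(t)=e^{2\pi i\omega\cdot t}f(t)$; $\sigma((x,\omega),(x',\omega'))=x\cdot\omega'-\omega\cdot x'$. $M^p(\mathbb R^n)$ is the set of tempered distributions $f$ with $z\mapsto\langle f,\rho(z)\varphi\rangle$ in $L^p(\mathbb R^{2n})$ for a fixed nonzero Schwartz $\varphi$; $M^\infty$ is the dual of $M^1$, and $\langle\rho(z)\psi,h\rangle=\langle\psi,\rho(-z)h\rangle$. $D=\operatorname{diag}(d_1,\dots,d_n)$, positive integers $d_1\mid\cdots\mid d_n$, $d=\prod_jd_j$. $\Lambda_D=D^{1/2}\mathbb Z^n\times D^{1/2}\mathbb Z^n$, $\Lambda_D^\circ=D^{-1/2}\mathbb Z^n\times D^{-1/2}\mathbb Z^n$, $\chi_D(D^{1/2}k,D^{1/2}\ell)=(-1)^{k^TD\ell}$, $S_\lambda=\chi_D(\lambda)\rho(\lambda)$, $\mathcal C_{\Lambda_D}=\{\psi\in M^\infty(\mathbb R^n):S_\lambda\psi=\psi\ \forall\lambda\in\Lambda_D\}$. $\mathbb Z_{\mathbf d}=\prod_j\mathbb Z_{d_j}$, $\mathcal H_{\mathbf d}=\bigotimes_j\mathbb C^{d_j}$, $\delta_r=D^{-1/2}r$. For $h\in M^1(\mathbb R^n)$,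 $Z_Dh(x,\omega)=\sum_{\gamma\in D^{1/2}\mathbb Z^n}h(x-\gamma)e^{2\pi i\gamma\cdot\omega}$ and $(\mathcal Z_Dh(x,\omega))_r=e^{-2\pi i\delta_r\cdot\omega}Z_Dh(x+\delta_r,\omega)$, $r\in\mathbb Z_{\mathbf d}$. $K_D=\Lambda_D^\circ/\Lambda_D\cong\mathbb Z_{\mathbf d}\times\mathbb Z_{\mathbf d}$; for $q=(r,s)$ with fixed integer representatives, $\nu_q=(D^{-1/2}r,D^{-1/2}s)$. Frame and coefficients: $\{\rho(\lambda)g_j:\lambda\in\Lambda_D,1\le j\le m\}$ is a frame of $L^2(\mathbb R^n)$, $\gamma_j=S^{-1}g_j$ with $S$ the frame operator. With $h_\alpha=\sum_s\overline{\alpha_s}g_s$ and $\widehat\rho(\mu)\boldsymbol\gamma=(\rho(\mu)\gamma_1,\dots,\rho(\mu)\gamma_m)$, $\Phi_{\boldsymbol\gamma,\alpha}(F)=\sum_{\mu\in\Lambda_D^\circ}a_\mu(\Phi_{\boldsymbol\gamma,\alpha}(F))\widehat\rho(\mu)\boldsymbol\gamma$ for $F\in M^\infty(\mathbb R^n)$, where $a_\mu(\Phi_{\boldsymbol\gamma,\alpha}(F))=\frac1d\langle F,\rho(\mu)h_\alpha\rangle$. The blocks are $$B_\lambda^{(\zeta)}(f)=\frac{\sqrt d}{\|v_\alpha\|}\Bigl(e^{\pi i\sigma(\lambda,\nu_q)}a_{\lambda+\nu_q}\bigl(\Phi_{\boldsymbol\gamma,\alpha}(\rho(\zeta)f)\bigr)\Bigr)_{q\in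 K_D}\in\ell^2(K_D).$$ *)

theory Defs
  imports "HOL-Analysis.Analysis"
begin

type_synonym 'n phase = "(real ^ 'n) \<times> (real ^ 'n)"
type_synonym 'n ivec = "int ^ 'n"
type_synonym 'n cfun = "real ^ 'n \<Rightarrow> complex"
type_synonym 'n distr = "'n cfun \<Rightarrow> complex"

definition rho :: "'n::finite phase \<Rightarrow> 'n cfun \<Rightarrow> 'n cfun" where
  "rho z f = (\<lambda>t. cis (- pi * (fst z \<bullet> snd z)) * (cis (2 * pi * (snd z \<bullet> t)) * f (t - fst z)))"

definition sigma_form :: "'n::finite phase \<Rightarrow> 'n phase \<Rightarrow> real" where
  "sigma_form z z' = fst z \<bullet> snd z' - snd z \<bullet> fst z'"

definition pderiv_dir :: "'n::finite \<Rightarrow> 'n cfun \<Rightarrow> 'n cfun" where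
  "pderiv_dir i f = (\<lambda>x. frechet_derivative f (at x) (axis i 1))"

text \<open>Iterated partial derivatives, indexed by the list of directions.\<close>

definition pderivs :: "'n::finite list \<Rightarrow> 'n cfun \<Rightarrow> 'n cfun" where
  "pderivs l f = foldr pderiv_dir l f"

definition schwartz :: "'n::finite cfun set" where
  "schwartz = {f. \<forall>l. (\<forall>x. pderivs l f differentiable (at x)) \<and>
                      (\<forall>k::nat. bounded (range (\<lambda>x. (1 + norm x) ^ k *\<^sub>R pderivs l f x)))}"

definition schwartz_norm :: "nat \<Rightarrow> 'n::finite cfun \<Rightarrow> real" where
  "schwartz_norm N f =
     (\<Sum>l\<in>{l. length l \<le> N}. SUP x. (1 + norm x) ^ N * norm (pderivs l f x))"

text \<open>
  Brackets are linear in the first and conjugate-linear in the second slot, so a tempered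
  distribution \<open>u\<close> is given by the continuous conjugate-linear functional
  \<open>\<psi> \<mapsto> \<langle>u, \<psi>\<rangle>\<close> on Schwartz space. Functionals are extended by \<open>0\<close> to non-Schwartz
  functions, so that equality of distributions is equality in HOL.
\<close>

definition tempered :: "'n::finite distr set" where
  "tempered = {u.
     (\<forall>\<psi>. \<psi> \<notin> schwartz \<longrightarrow> u \<psi> = 0) \<and>
     (\<forall>\<psi>\<in>schwartz. \<forall>\<eta>\<in>schwartz. u (\<lambda>t. \<psi> t + \<eta> t) = u \<psi> + u \<eta>) \<and>
     (\<forall>c. \<forall>\<psi>\<in>schwartz. u (\<lambda>t. c * \<psi> t) = cnj c * u \<psi>) \<and>
     (\<exists>C N. \<forall>\<psi>\<in>schwartz. norm (u \<psi>) \<le> C * schwartz_norm N \<psi>)}"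

definition l2_inner :: "'n::finite cfun \<Rightarrow> 'n cfun \<Rightarrow> complex" where
  "l2_inner f h = (\<integral>t. f t * cnj (h t) \<partial>lborel)"

definition distr_of :: "'n::finite cfun \<Rightarrow> 'n distr" where
  "distr_of h = (\<lambda>\<psi>. if \<psi> \<in> schwartz then l2_inner h \<psi> else 0)"

definition rho_distr :: "'n::finite phase \<Rightarrow> 'n distr \<Rightarrow> 'n distr" where
  "rho_distr z u = (\<lambda>\<psi>. u (rho (- z) \<psi>))"

definition stft :: "'n::finite cfun \<Rightarrow> 'n distr \<Rightarrow> 'n phase \<Rightarrow> complex" where
  "stft \<phi> u = (\<lambda>z. u (rho z \<phi>))"

text \<open>
  The parameter \<open>\<phi>\<close> is the fixed nonzero Schwartz window. An element of \<open>M\<^sup>1\<close> is represented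
  by its unique continuous representative, so that it can be evaluated pointwise.
\<close>

definition M1 :: "'n::finite cfun \<Rightarrow> 'n cfun set" where
  "M1 \<phi> = {h. continuous_on UNIV h \<and>
              (\<forall>\<psi>\<in>schwartz. integrable lborel (\<lambda>t. h t * cnj (\<psi> t))) \<and>
              distr_of h \<in> tempered \<and>
              integrable lborel (stft \<phi> (distr_of h))}"

definition Minf :: "'n::finite cfun \<Rightarrow> 'n distr set" where
  "Minf \<phi> = {u \<in> tempered. stft \<phi> u \<in> borel_measurable lborel \<and>
                           (\<exists>C. AE z in lborel. norm (stft \<phi> u z) \<le> C)}"

definition L2 :: "'n::finite cfun set" where
  "L2 = {f \<in> borel_measurable lborel. integrable lborel (\<lambda>t. (norm (f t))\<^sup>2)}"

definition l2_norm :: "'n::finite cfun \<Rightarrow> real" where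
  "l2_norm f = sqrt (\<integral>t. (norm (f t))\<^sup>2 \<partial>lborel)"

text \<open>
  The duality between \<open>M\<^sup>\<infinity>\<close> and \<open>M\<^sup>1\<close>. By the orthogonality relation
  \<open>\<integral> V\<^sub>\<phi>f \<cdot> cnj (V\<^sub>\<phi>h) = \<parallel>\<phi>\<parallel>\<^sup>2 \<langle>f, h\<rangle>\<close> for the short-time Fourier transform it extends the
  \<open>L\<^sup>2\<close> inner product.
\<close>

definition pairing :: "'n::finite cfun \<Rightarrow> 'n distr \<Rightarrow> 'n cfun \<Rightarrow> complex" where
  "pairing \<phi> u h =
     (\<integral>z. stft \<phi> u z * cnj (stft \<phi> (distr_of h) z) \<partial>lborel) / of_real ((l2_norm \<phi>)\<^sup>2)"

text \<open>
  The matrix \<open>D\<close> is given by its diagonal \<open>d\<close>; the linear order on the index type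
  \<open>'n\<close> provides the order of the diagonal entries.
\<close>

definition elementary_divisors :: "('n::{finite,linorder} \<Rightarrow> nat) \<Rightarrow> bool" where
  "elementary_divisors d \<longleftrightarrow> (\<forall>i. d i > 0) \<and> (\<forall>i j. i \<le> j \<longrightarrow> d i dvd d j)"

definition Dhalf :: "('n::finite \<Rightarrow> nat) \<Rightarrow> 'n ivec \<Rightarrow> real ^ 'n" where
  "Dhalf d k = (\<chi> i. sqrt (real (d i)) * real_of_int (k $ i))"

definition Dmhalf :: "('n::finite \<Rightarrow> nat) \<Rightarrow> 'n ivec \<Rightarrow> real ^ 'n" where
  "Dmhalf d k = (\<chi> i. real_of_int (k $ i) / sqrt (real (d i)))"

definition Lat :: "('n::finite \<Rightarrow> nat) \<Rightarrow> 'n phase set" where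
  "Lat d = range (Dhalf d) \<times> range (Dhalf d)"

definition adjLat :: "('n::finite \<Rightarrow> nat) \<Rightarrow> 'n phase set" where
  "adjLat d = range (Dmhalf d) \<times> range (Dmhalf d)"

definition chiD :: "('n::finite \<Rightarrow> nat) \<Rightarrow> 'n phase \<Rightarrow> complex" where
  "chiD d z = (THE c. \<exists>k l. z = (Dhalf d k, Dhalf d l) \<and>
                            c = (- 1) powi (\<Sum>i\<in>UNIV. k $ i * int (d i) * l $ i))"

definition S_op :: "('n::finite \<Rightarrow> nat) \<Rightarrow> 'n phase \<Rightarrow> 'n distr \<Rightarrow> 'n distr" where
  "S_op d z u = (\<lambda>\<psi>. chiD d z * rho_distr z u \<psi>)"

definition invariant_space :: "'n::finite cfun \<Rightarrow> ('n \<Rightarrow> nat) \<Rightarrow> 'n distr set" where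
  "invariant_space \<phi> d = {u \<in> Minf \<phi>. \<forall>z\<in>Lat d. S_op d z u = u}"

text \<open>\<open>Zmod d\<close> is the product of the groups \<open>\<int>/d\<^sub>j\<close>, as a set of residue vectors.\<close>

definition Zmod :: "('n::finite \<Rightarrow> nat) \<Rightarrow> ('n ivec) set" where
  "Zmod d = {r. \<forall>i. 0 \<le> r $ i \<and> r $ i < int (d i)}"

definition zak :: "('n::finite \<Rightarrow> nat) \<Rightarrow> 'n cfun \<Rightarrow> 'n phase \<Rightarrow> complex" where
  "zak d h z = (\<Sum>\<^sub>\<infinity>\<gamma>\<in>range (Dhalf d). h (fst z - \<gamma>) * cis (2 * pi * (\<gamma> \<bullet> snd z)))"

text \<open>
  Vectors of the tensor product of the spaces \<open>\<complex>\<^bsup>d\<^sub>j\<^esup>\<close> and of \<open>\<ell>\<^sup>2(K\<^sub>D)\<close> are complex functions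
  vanishing off the index sets \<open>Zmod d\<close> and \<open>KD d\<close>.
\<close>

definition zak_vec :: "('n::finite \<Rightarrow> nat) \<Rightarrow> 'n cfun \<Rightarrow> 'n phase \<Rightarrow> 'n ivec \<Rightarrow> complex" where
  "zak_vec d h z = (\<lambda>r. if r \<in> Zmod d
     then cis (- 2 * pi * (Dmhalf d r \<bullet> snd z)) * zak d h (fst z + Dmhalf d r, snd z) else 0)"

definition vec_norm :: "('n::finite \<Rightarrow> nat) \<Rightarrow> ('n ivec \<Rightarrow> complex) \<Rightarrow> real" where
  "vec_norm d v = sqrt (\<Sum>r\<in>Zmod d. (norm (v r))\<^sup>2)"

definition KD :: "('n::finite \<Rightarrow> nat) \<Rightarrow> ('n ivec \<times> 'n ivec) set" where
  "KD d = Zmod d \<times> Zmod d"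

text \<open>An arbitrary choice of integer representatives of the residue classes in \<open>KD d\<close>.\<close>

definition representatives ::
  "('n::finite \<Rightarrow> nat) \<Rightarrow> ('n ivec \<times> 'n ivec \<Rightarrow> 'n ivec \<times> 'n ivec) \<Rightarrow> bool" where
  "representatives d rep \<longleftrightarrow> (\<forall>q\<in>KD d. \<forall>i.
     fst (rep q) $ i mod int (d i) = fst q $ i mod int (d i) \<and>
     snd (rep q) $ i mod int (d i) = snd q $ i mod int (d i))"

definition nu :: "('n::finite \<Rightarrow> nat) \<Rightarrow> ('n ivec \<times> 'n ivec \<Rightarrow> 'n ivec \<times> 'n ivec)
    \<Rightarrow> 'n ivec \<times> 'n ivec \<Rightarrow> 'n phase" where
  "nu d rep q = (Dmhalf d (fst (rep q)), Dmhalf d (snd (rep q)))"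

definition gabor_frame :: "('n::finite \<Rightarrow> nat) \<Rightarrow> ('m::finite \<Rightarrow> 'n cfun) \<Rightarrow> bool" where
  "gabor_frame d g \<longleftrightarrow> (\<forall>j. g j \<in> L2) \<and>
     (\<exists>A>0. \<exists>B. \<forall>f\<in>L2.
        (\<lambda>(z, j). (norm (l2_inner f (rho z (g j))))\<^sup>2) summable_on (Lat d \<times> UNIV) \<and>
        A * (l2_norm f)\<^sup>2 \<le> (\<Sum>\<^sub>\<infinity>(z, j)\<in>Lat d \<times> UNIV. (norm (l2_inner f (rho z (g j))))\<^sup>2) \<and>
        (\<Sum>\<^sub>\<infinity>(z, j)\<in>Lat d \<times> UNIV. (norm (l2_inner f (rho z (g j))))\<^sup>2) \<le> B * (l2_norm f)\<^sup>2)"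

text \<open>
  \<open>frame_op_eq d g f h\<close> says that the frame operator maps \<open>f\<close> to \<open>h\<close>: the series
  \<open>\<Sum> \<langle>f, \<rho>(\<lambda>)g\<^sub>j\<rangle> \<rho>(\<lambda>)g\<^sub>j\<close> converges unconditionally to \<open>h\<close> in \<open>L\<^sup>2\<close>.
\<close>

definition frame_op_eq ::
  "('n::finite \<Rightarrow> nat) \<Rightarrow> ('m::finite \<Rightarrow> 'n cfun) \<Rightarrow> 'n cfun \<Rightarrow> 'n cfun \<Rightarrow> bool" where
  "frame_op_eq d g f h \<longleftrightarrow>
     ((\<lambda>F. l2_norm (\<lambda>t. h t - (\<Sum>(z, j)\<in>F. l2_inner f (rho z (g j)) * rho z (g j) t))) \<longlongrightarrow> 0)
       (finite_subsets_at_top (Lat d \<times> UNIV))"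

definition canonical_dual ::
  "('n::finite \<Rightarrow> nat) \<Rightarrow> ('m::finite \<Rightarrow> 'n cfun) \<Rightarrow> ('m \<Rightarrow> 'n cfun) \<Rightarrow> bool" where
  "canonical_dual d g \<gamma> \<longleftrightarrow> (\<forall>j. \<gamma> j \<in> L2 \<and> frame_op_eq d g (\<gamma> j) (g j))"

definition h_alpha :: "('m::finite \<Rightarrow> 'n::finite cfun) \<Rightarrow> complex ^ 'm \<Rightarrow> 'n cfun" where
  "h_alpha g \<alpha> = (\<lambda>t. \<Sum>s\<in>UNIV. cnj (\<alpha> $ s) * g s t)"

definition v_alpha ::
  "('n::finite \<Rightarrow> nat) \<Rightarrow> ('m::finite \<Rightarrow> 'n cfun) \<Rightarrow> complex ^ 'm \<Rightarrow> 'n ivec \<Rightarrow> complex" where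
  "v_alpha d g \<alpha> = (\<lambda>r. \<Sum>s\<in>UNIV. cnj (\<alpha> $ s) * zak_vec d (g s) (0, 0) r)"

text \<open>The coefficient \<open>a\<^sub>\<mu>(\<Phi>(u))\<close> in the expansion defining \<open>\<Phi>(u)\<close> (\<open>Phi\<close> below).\<close>

definition Phi_coeff :: "'n::finite cfun \<Rightarrow> ('n \<Rightarrow> nat) \<Rightarrow> ('m::finite \<Rightarrow> 'n cfun) \<Rightarrow> complex ^ 'm
    \<Rightarrow> 'n distr \<Rightarrow> 'n phase \<Rightarrow> complex" where
  "Phi_coeff \<phi> d g \<alpha> u \<mu> = pairing \<phi> u (rho \<mu> (h_alpha g \<alpha>)) / of_nat (\<Prod>i\<in>UNIV. d i)"

text \<open>
  Component \<open>j\<close> of \<open>\<Phi>(u)\<close>, the series being understood in the weak sense. The dual windows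
  \<open>\<gamma>\<close> enter only here; the coefficients themselves do not depend on them.
\<close>

definition Phi :: "'n::finite cfun \<Rightarrow> ('n \<Rightarrow> nat) \<Rightarrow> ('m::finite \<Rightarrow> 'n cfun) \<Rightarrow> ('m \<Rightarrow> 'n cfun)
    \<Rightarrow> complex ^ 'm \<Rightarrow> 'n distr \<Rightarrow> 'm \<Rightarrow> 'n distr" where
  "Phi \<phi> d g \<gamma> \<alpha> u j =
     (\<lambda>\<psi>. \<Sum>\<^sub>\<infinity>\<mu>\<in>adjLat d. Phi_coeff \<phi> d g \<alpha> u \<mu> * distr_of (rho \<mu> (\<gamma> j)) \<psi>)"

definition block :: "'n::finite cfun \<Rightarrow> ('n \<Rightarrow> nat) \<Rightarrow> ('m::finite \<Rightarrow> 'n cfun) \<Rightarrow> complex ^ 'm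
    \<Rightarrow> ('n ivec \<times> 'n ivec \<Rightarrow> 'n ivec \<times> 'n ivec)
    \<Rightarrow> 'n phase \<Rightarrow> 'n phase \<Rightarrow> 'n distr \<Rightarrow> 'n ivec \<times> 'n ivec \<Rightarrow> complex" where
  "block \<phi> d g \<alpha> rep \<zeta> z f = (\<lambda>q. if q \<in> KD d
     then of_real (sqrt (real (\<Prod>i\<in>UNIV. d i)) / vec_norm d (v_alpha d g \<alpha>)) *
          (cis (pi * sigma_form z (nu d rep q)) *
           Phi_coeff \<phi> d g \<alpha> (rho_distr \<zeta> f) (z + nu d rep q))
     else 0)"

definition s_char :: "('n::finite \<Rightarrow> nat) \<Rightarrow> 'n phase \<Rightarrow> 'n phase \<Rightarrow> complex" where
  "s_char d z \<zeta> = chiD d z * cis (2 * pi * sigma_form z \<zeta>)"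

end

theory Submission
  imports Defs
begin

text \<open>
  Substituting \<open>z \<mapsto> z + \<lambda>\<close> in the integral defining \<open>\<langle>\<rho>(\<zeta>)f, \<rho>(\<mu> + \<lambda>)h\<rangle>\<close>, the operator
  \<open>\<rho>(\<lambda>)\<close> cancels by unitarity in the second factor, while in the first it is commuted past \<open>\<rho>(-\<zeta>)\<close>
  and absorbed by the invariance of \<open>f\<close>. The phases depending on \<open>z\<close> cancel, and what remains is
  \<open>\<chi>\<^sub>D(\<lambda>) e\<^bsup>2\<pi>i\<sigma>(\<lambda>,\<zeta>)\<^esup> e\<^bsup>-\<pi>i\<sigma>(\<lambda>,\<mu>)\<^esup>\<close>.
\<close>

section \<open>Algebra and unitarity of the time-frequency shifts\<close>

lemma rho_rho:
  "rho z (rho w f) = (\<lambda>t. cis (- pi * sigma_form z w) * rho (z + w) f t)"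
proof
  fix t
  \<comment> \<open>Moving the modulation by \<open>snd w\<close> past the translation by
    \<open>fst z\<close> costs the phase \<open>- 2 * pi * (fst z \<bullet> snd w)\<close>. The
    symmetric normalisation of \<open>rho\<close> absorbs its symmetric half, and the antisymmetric
    half is the symplectic form.\<close>
  have "- pi * (fst z \<bullet> snd z) + (2 * pi * (snd z \<bullet> t) + (- pi * (fst w \<bullet> snd w)
          + 2 * pi * (snd w \<bullet> (t - fst z))))
      = - pi * sigma_form z w + (- pi * (fst (z + w) \<bullet> snd (z + w)) + 2 * pi * (snd (z + w) \<bullet> t))"
    by (simp add: sigma_form_def inner_simps algebra_simps inner_commute)
  then show "rho z (rho w f) t = cis (- pi * sigma_form z w) * rho (z + w) f t"
    by (simp add: rho_def cis_mult diff_diff_eq flip: mult.assoc)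
qed

lemma rho_scale: "rho z (\<lambda>t. c * f t) = (\<lambda>t. c * rho z f t)"
  by (auto simp: rho_def)

lemma sigma_form_simps:
  "sigma_form z z = 0"
  "sigma_form (z + z') w = sigma_form z w + sigma_form z' w"
  "sigma_form z (w + w') = sigma_form z w + sigma_form z w'"
  "sigma_form z (w - w') = sigma_form z w - sigma_form z w'"
  "sigma_form (- z) w = - sigma_form z w"
  "sigma_form z (- w) = - sigma_form z w"
  "sigma_form 0 w = 0"
  by (simp_all add: sigma_form_def inner_simps inner_commute)

lemma sigma_form_swap: "sigma_form w z = - sigma_form z w"
  by (simp add: sigma_form_def inner_commute)

text \<open>For measurable \<open>F\<close> this is translation invariance of Lebesgue measure.
  Otherwise translating back shows that the shifted function is not measurable either, and both
  integrals take the default value 0. Stated for arbitrary \<open>F\<close>, it can be applied to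
  the pairing without a separate integrability argument.\<close>

lemma integral_lborel_translate:
  fixes F :: "'a::euclidean_space \<Rightarrow> complex"
  shows "(\<integral>t. F (t + a) \<partial>lborel) = (\<integral>t. F t \<partial>lborel)"
proof -
  have *: "integral\<^sup>L lborel F = (\<integral>t. F (t + a) \<partial>lborel)"
    if "F \<in> borel_measurable lborel" for a and F :: "'a \<Rightarrow> complex"
  proof -
    have "integral\<^sup>L lborel F = integral\<^sup>L (distr lborel borel ((+) a)) F"
      by (simp add: lborel_distr_plus)
    also have "\<dots> = (\<integral>t. F (a + t) \<partial>lborel)"
      using that by (intro integral_distr) auto
    finally show ?thesis
      by (simp add: add.commute)
  qed
  show ?thesis
  proof (cases "F \<in> borel_measurable lborel")
    case True
    then show ?thesis using * by metis
  next
    case False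
    have "(\<lambda>t. F (t + a)) \<notin> borel_measurable lborel"
    proof
      assume m: "(\<lambda>t. F (t + a)) \<in> borel_measurable lborel"
      have "(\<lambda>t. F ((t - a) + a)) \<in> borel_measurable lborel"
        by (rule measurable_compose [OF _ m]) measurable
      with False show False by simp
    qed
    then have "\<not> integrable lborel F" "\<not> integrable lborel (\<lambda>t. F (t + a))"
      using False borel_measurable_integrable by blast+
    then show ?thesis
      by (simp add: not_integrable_integral_eq)
  qed
qed

lemma l2_inner_scale:
  "l2_inner (\<lambda>t. a * f t) (\<lambda>t. b * h t) = a * cnj b * l2_inner f h"
proof -
  have "l2_inner (\<lambda>t. a * f t) (\<lambda>t. b * h t) = (\<integral>t. (a * cnj b) * (f t * cnj (h t)) \<partial>lborel)"
    unfolding l2_inner_def by (simp add: mult_ac)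
  then show ?thesis
    by (simp add: l2_inner_def)
qed

text \<open>The phases are unimodular and cancel pointwise against their conjugates; what is left is
  a translate of the original integrand.\<close>

lemma l2_inner_rho: "l2_inner (rho z f) (rho z h) = l2_inner f h"
proof -
  have "rho z f t * cnj (rho z h t) = f (t + - fst z) * cnj (h (t + - fst z))" for t
  proof -
    have "rho z f t * cnj (rho z h t)
        = (cis (- pi * (fst z \<bullet> snd z)) * cnj (cis (- pi * (fst z \<bullet> snd z))))
          * (cis (2 * pi * (snd z \<bullet> t)) * cnj (cis (2 * pi * (snd z \<bullet> t))))
          * (f (t - fst z) * cnj (h (t - fst z)))"
      unfolding rho_def complex_cnj_mult by (simp only: mult_ac)
    then show ?thesis
      by (simp add: cis_cnj cis_mult)
  qed
  then show ?thesis
    unfolding l2_inner_def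
    by (simp only: integral_lborel_translate [where F = "\<lambda>t. f t * cnj (h t)"])
qed

section \<open>Schwartz space and its invariance under time-frequency shifts\<close>

lemma pderiv_dir_eqI:
  assumes "\<And>x. (f has_derivative f' x) (at x)"
  shows "pderiv_dir i f = (\<lambda>x. f' x (axis i 1))"
  unfolding pderiv_dir_def using frechet_derivative_at [OF assms] by metis

lemma schwartzD:
  assumes "f \<in> schwartz"
  shows "f differentiable (at x)"
    and "bounded (range (\<lambda>x. (1 + norm x) ^ k *\<^sub>R f x))"
    and "pderiv_dir i f \<in> schwartz"
proof -
  have *: "\<forall>x. pderivs l f differentiable (at x)"
    "\<forall>k::nat. bounded (range (\<lambda>x. (1 + norm x) ^ k *\<^sub>R pderivs l f x))" for l
    using assms unfolding schwartz_def by blast+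
  show "f differentiable (at x)" "bounded (range (\<lambda>x. (1 + norm x) ^ k *\<^sub>R f x))"
    using * [of "[]"] by (simp_all add: pderivs_def)
  \<comment> \<open>\<open>foldr\<close> applies the last direction of the list first, so a
    preliminary derivative is appended at the end.\<close>
  have "pderivs l (pderiv_dir i f) = pderivs (l @ [i]) f" for l
    by (simp add: pderivs_def)
  with * show "pderiv_dir i f \<in> schwartz"
    unfolding schwartz_def by (intro CollectI allI) metis
qed

lemma schwartz_has_derivative:
  assumes "f \<in> schwartz"
  shows "(f has_derivative frechet_derivative f (at x)) (at x)"
  using schwartzD(1) [OF assms] by (simp flip: frechet_derivative_works)

text \<open>Schwartz space is the largest class with these three closure properties.\<close>

lemma schwartz_coinduct:
  assumes "P f"
    and "\<And>h x. P h \<Longrightarrow> h differentiable (at x)"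
    and "\<And>h k. P h \<Longrightarrow> bounded (range (\<lambda>x. (1 + norm x) ^ k *\<^sub>R h x))"
    and "\<And>h i. P h \<Longrightarrow> P (pderiv_dir i h)"
  shows "f \<in> schwartz"
proof -
  have "P (pderivs l f)" for l
    by (induction l) (auto simp: pderivs_def assms(1) intro: assms(4))
  then show ?thesis
    unfolding schwartz_def using assms(2,3) by blast
qed

text \<open>Coinduction with \<open>c\<close> fixed and both functions varying: differentiating a
  combination gives the same combination of derivatives.\<close>

lemma schwartz_add_scale:
  assumes "f \<in> schwartz" and "h \<in> schwartz"
  shows "(\<lambda>x. f x + c * h x) \<in> schwartz"
proof (rule schwartz_coinduct [where
      P = "\<lambda>u. \<exists>f\<in>schwartz. \<exists>h\<in>schwartz. u = (\<lambda>x. f x + c * h x)"])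
  show "\<exists>f'\<in>schwartz. \<exists>h'\<in>schwartz. (\<lambda>x. f x + c * h x) = (\<lambda>x. f' x + c * h' x)"
    using assms by blast
next
  fix u :: "'a cfun" and x
  assume "\<exists>f\<in>schwartz. \<exists>h\<in>schwartz. u = (\<lambda>x. f x + c * h x)"
  then show "u differentiable (at x)"
    by (auto intro!: differentiable_add differentiable_mult differentiable_const intro: schwartzD(1))
next
  fix u :: "'a cfun" and k
  assume "\<exists>f\<in>schwartz. \<exists>h\<in>schwartz. u = (\<lambda>x. f x + c * h x)"
  then obtain f h where fh: "f \<in> schwartz" "h \<in> schwartz" and u: "u = (\<lambda>x. f x + c * h x)"
    by blast
  have "bounded ((\<lambda>y. c * y) ` range (\<lambda>x. (1 + norm x) ^ k *\<^sub>R h x))"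
    by (intro bounded_linear_image schwartzD(2) fh bounded_linear_mult_right)
  then have "bounded (range (\<lambda>x. c * ((1 + norm x) ^ k *\<^sub>R h x)))"
    by (simp add: image_image)
  from bounded_plus_comp [OF schwartzD(2) [OF fh(1)] this]
  show "bounded (range (\<lambda>x. (1 + norm x) ^ k *\<^sub>R u x))"
    by (simp add: u scaleR_right_distrib mult_scaleR_right)
next
  fix u :: "'a cfun" and i
  assume "\<exists>f\<in>schwartz. \<exists>h\<in>schwartz. u = (\<lambda>x. f x + c * h x)"
  then obtain f h where fh: "f \<in> schwartz" "h \<in> schwartz" and u: "u = (\<lambda>x. f x + c * h x)"
    by blast
  have "pderiv_dir i u = (\<lambda>x. pderiv_dir i f x + c * pderiv_dir i h x)"
    unfolding u
    by (subst pderiv_dir_eqI,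
        rule has_derivative_add [OF schwartz_has_derivative [OF fh(1)]
          has_derivative_mult_right [OF schwartz_has_derivative [OF fh(2)]]])
       (simp add: pderiv_dir_def)
  with fh show "\<exists>f\<in>schwartz. \<exists>h\<in>schwartz. pderiv_dir i u = (\<lambda>x. f x + c * h x)"
    using schwartzD(3) by blast
qed

lemma zero_in_schwartz: "(\<lambda>_. 0) \<in> schwartz"
  by (rule schwartz_coinduct [where P = "\<lambda>u. u = (\<lambda>_. 0)"])
     (auto simp: pderiv_dir_eqI [OF has_derivative_const])

lemma schwartz_scale: "f \<in> schwartz \<Longrightarrow> (\<lambda>x. c * f x) \<in> schwartz"
  using schwartz_add_scale [OF zero_in_schwartz, of f c] by simp

text \<open>The weight is submultiplicative,
  \<open>1 + norm x \<le> (1 + norm a) * (1 + norm (x - a))\<close>, so a translation by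
  \<open>a\<close> costs at most the constant factor \<open>(1 + norm a) ^ k\<close>.\<close>

lemma bounded_weighted_translate:
  fixes f :: "'a::real_normed_vector \<Rightarrow> 'b::real_normed_vector"
  assumes "bounded (range (\<lambda>x. (1 + norm x) ^ k *\<^sub>R f x))"
  shows "bounded (range (\<lambda>x. (1 + norm x) ^ k *\<^sub>R f (x - a)))"
proof -
  obtain B where B: "\<And>x. (1 + norm x) ^ k * norm (f x) \<le> B"
    using assms by (auto simp: bounded_iff)
  have "(1 + norm x) ^ k * norm (f (x - a)) \<le> (1 + norm a) ^ k * B" for x
  proof -
    have "norm x \<le> norm a + norm (x - a)"
      by (metis norm_triangle_sub)
    moreover have "0 \<le> norm a * norm (x - a)"
      by simp
    ultimately have "1 + norm x \<le> (1 + norm a) * (1 + norm (x - a))"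
      unfolding distrib_right distrib_left mult_1_left mult_1_right by linarith
    then have "(1 + norm x) ^ k \<le> (1 + norm a) ^ k * (1 + norm (x - a)) ^ k"
      by (metis power_mono power_mult_distrib add_nonneg_nonneg norm_ge_zero zero_le_one)
    then have "(1 + norm x) ^ k * norm (f (x - a))
        \<le> (1 + norm a) ^ k * ((1 + norm (x - a)) ^ k * norm (f (x - a)))"
      by (metis mult_right_mono norm_ge_zero mult.assoc)
    also have "\<dots> \<le> (1 + norm a) ^ k * B"
      by (intro mult_left_mono B) simp
    finally show ?thesis .
  qed
  then show ?thesis
    by (auto simp: bounded_iff)
qed

lemma has_derivative_cis_mult_translate:
  fixes f :: "'n::finite cfun"
  assumes "f \<in> schwartz"
  shows "((\<lambda>t. cis (2 * pi * (\<omega> \<bullet> t)) * f (t - a)) has_derivative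
     (\<lambda>v. cis (2 * pi * (\<omega> \<bullet> t)) * (frechet_derivative f (at (t - a)) v
            + 2 * pi * (\<omega> \<bullet> v) * \<i> * f (t - a)))) (at t)"
proof -
  have "((\<lambda>t. f (t - a)) has_derivative
      (\<lambda>v. frechet_derivative f (at (t - a)) (v - 0))) (at t)"
    using schwartz_has_derivative [OF assms, of "t - a"]
    by (intro has_derivative_compose [where g = f and f = "\<lambda>t. t - a"] derivative_intros) auto
  moreover have "((\<lambda>t. cis (2 * pi * (\<omega> \<bullet> t))) has_derivative
      (\<lambda>v. (2 * pi * (\<omega> \<bullet> v)) *\<^sub>R (\<i> * cis (2 * pi * (\<omega> \<bullet> t))))) (at t)"
    by (auto intro!: derivative_eq_intros)
  ultimately show ?thesis
    by (auto intro!: derivative_eq_intros simp: algebra_simps scaleR_conv_of_real)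
qed

text \<open>Coinduction with frequency and shift fixed: a partial derivative of a modulated
  translate of \<open>f\<close> is the same modulated translate of the Schwartz function
  \<open>h\<close> below. This avoids a Leibniz expansion of higher derivatives.\<close>

lemma schwartz_cis_mult_translate:
  assumes "f \<in> schwartz"
  shows "(\<lambda>t. cis (2 * pi * (\<omega> \<bullet> t)) * f (t - a)) \<in> schwartz"
proof (rule schwartz_coinduct [where
      P = "\<lambda>u. \<exists>f\<in>schwartz. u = (\<lambda>t. cis (2 * pi * (\<omega> \<bullet> t)) * f (t - a))"])
  show "\<exists>f'\<in>schwartz. (\<lambda>t. cis (2 * pi * (\<omega> \<bullet> t)) * f (t - a))
      = (\<lambda>t. cis (2 * pi * (\<omega> \<bullet> t)) * f' (t - a))"
    using assms by blast
next
  fix u :: "'a cfun" and t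
  assume "\<exists>f\<in>schwartz. u = (\<lambda>t. cis (2 * pi * (\<omega> \<bullet> t)) * f (t - a))"
  then show "u differentiable (at t)"
    using has_derivative_cis_mult_translate unfolding differentiable_def by blast
next
  fix u :: "'a cfun" and k
  assume "\<exists>f\<in>schwartz. u = (\<lambda>t. cis (2 * pi * (\<omega> \<bullet> t)) * f (t - a))"
  then obtain f where f: "f \<in> schwartz" and u: "u = (\<lambda>t. cis (2 * pi * (\<omega> \<bullet> t)) * f (t - a))"
    by blast
  show "bounded (range (\<lambda>x. (1 + norm x) ^ k *\<^sub>R u x))"
    using bounded_weighted_translate [OF schwartzD(2) [OF f], of k a]
    by (simp add: u bounded_iff norm_mult)
next
  fix u :: "'a cfun" and i
  assume "\<exists>f\<in>schwartz. u = (\<lambda>t. cis (2 * pi * (\<omega> \<bullet> t)) * f (t - a))"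
  then obtain f where f: "f \<in> schwartz" and u: "u = (\<lambda>t. cis (2 * pi * (\<omega> \<bullet> t)) * f (t - a))"
    by blast
  define h where "h = (\<lambda>t. pderiv_dir i f t + 2 * pi * (\<omega> \<bullet> axis i 1) * \<i> * f t)"
  have "h \<in> schwartz"
    unfolding h_def by (intro schwartz_add_scale schwartzD(3) f)
  moreover have "pderiv_dir i u = (\<lambda>t. cis (2 * pi * (\<omega> \<bullet> t)) * h (t - a))"
    unfolding u pderiv_dir_eqI [OF has_derivative_cis_mult_translate [OF f]] h_def
    by (simp add: pderiv_dir_def)
  ultimately show "\<exists>f\<in>schwartz. pderiv_dir i u = (\<lambda>t. cis (2 * pi * (\<omega> \<bullet> t)) * f (t - a))"
    by blast
qed

text \<open>Needed because distributions are conjugate-linear only on Schwartz functions and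
  \<open>distr_of\<close> is 0 off them.\<close>

lemma rho_in_schwartz: "f \<in> schwartz \<Longrightarrow> rho z f \<in> schwartz"
  unfolding rho_def by (intro schwartz_scale schwartz_cis_mult_translate)

section \<open>Behaviour of the two short-time Fourier transforms under a shift by
  \<open>l\<close>\<close>

lemma stft_invariant_translate:
  assumes "\<phi> \<in> schwartz" and "f \<in> invariant_space \<phi> d" and "l \<in> Lat d"
  shows "stft \<phi> (rho_distr \<zeta> f) (z + l) =
    chiD d l * cis (2 * pi * sigma_form l \<zeta>) * cis (- pi * sigma_form l z)
      * stft \<phi> (rho_distr \<zeta> f) z"
proof -
  have inv: "f \<psi> = chiD d l * f (rho (- l) \<psi>)" for \<psi>
  proof -
    have "S_op d l f = f"
      using assms(2,3) by (simp add: invariant_space_def)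
    from fun_cong [OF this, of \<psi>] show ?thesis
      by (simp add: S_op_def rho_distr_def)
  qed
  have hom: "f (\<lambda>t. c * \<psi> t) = cnj c * f \<psi>" if "\<psi> \<in> schwartz" for c \<psi>
    using that assms(2) by (simp add: invariant_space_def Minf_def tempered_def)
  \<comment> \<open>Both sides of the claim become values of \<open>f\<close> at unimodular
    multiples of one test function, \<open>rho (z - \<zeta>) \<phi>\<close>, so that only phases
    remain to be compared.\<close>
  have 1: "rho (- \<zeta>) (rho z \<phi>) = (\<lambda>t. cis (pi * sigma_form \<zeta> z) * rho (z - \<zeta>) \<phi> t)"
    by (simp add: rho_rho sigma_form_simps)
  have 2: "rho (- l) (rho (- \<zeta>) (rho (z + l) \<phi>))
      = (\<lambda>t. cis (- 2 * pi * sigma_form l \<zeta> + pi * sigma_form l z + pi * sigma_form \<zeta> z)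
               * rho (z - \<zeta>) \<phi> t)"
  proof -
    have "rho (- l) (rho (- \<zeta>) (rho (z + l) \<phi>))
        = (\<lambda>t. cis (pi * (sigma_form \<zeta> z + sigma_form \<zeta> l))
            * (cis (pi * (sigma_form l z - sigma_form l \<zeta>)) * rho (z - \<zeta>) \<phi> t))"
      by (simp add: rho_rho rho_scale sigma_form_simps) (simp add: algebra_simps)
    \<comment> \<open>The factor 2 arises here: by antisymmetry \<open>sigma_form \<zeta> l\<close>
      doubles the term \<open>- sigma_form l \<zeta>\<close>.\<close>
    moreover have "cis (pi * (sigma_form \<zeta> z + sigma_form \<zeta> l))
          * cis (pi * (sigma_form l z - sigma_form l \<zeta>))
        = cis (- 2 * pi * sigma_form l \<zeta> + pi * sigma_form l z + pi * sigma_form \<zeta> z)"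
      by (simp add: cis_mult sigma_form_swap [of \<zeta> l] algebra_simps)
    ultimately show ?thesis
      by (metis mult.assoc)
  qed
  have 3: "rho (z - \<zeta>) \<phi> \<in> schwartz"
    by (rule rho_in_schwartz [OF assms(1)])
  show ?thesis
    unfolding stft_def rho_distr_def inv [of "rho (- \<zeta>) (rho (z + l) \<phi>)"]
    unfolding 1 2 hom [OF 3]
    by (simp add: cis_cnj) (simp add: cis_mult algebra_simps)
qed

text \<open>Pulling \<open>rho l\<close> to the front in both slots lets unitarity remove it. The
  phase from the second slot is conjugated, hence the opposite signs.\<close>

lemma stft_rho_translate:
  assumes "\<phi> \<in> schwartz"
  shows "stft \<phi> (distr_of (rho (\<mu> + l) h)) (z + l) =
    cis (pi * sigma_form l \<mu>) * cis (- pi * sigma_form l z) * stft \<phi> (distr_of (rho \<mu> h)) z"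
proof -
  have split: "rho (w + l) k = (\<lambda>t. cis (pi * sigma_form l w) * rho l (rho w k) t)"
    for w and k :: "'a cfun"
    by (simp add: rho_rho cis_mult add.commute flip: mult.assoc)
  have "l2_inner (rho (\<mu> + l) h) (rho (z + l) \<phi>)
      = cis (pi * sigma_form l \<mu>) * cis (- pi * sigma_form l z) * l2_inner (rho \<mu> h) (rho z \<phi>)"
    unfolding split l2_inner_scale l2_inner_rho by (simp add: cis_cnj)
  then show ?thesis
    by (simp add: stft_def distr_of_def rho_in_schwartz assms)
qed

section \<open>Quasi-periodicity of the coefficients and of the blocks\<close>

lemma Phi_coeff_translate:
  assumes "\<phi> \<in> schwartz" and "f \<in> invariant_space \<phi> d" and "l \<in> Lat d"
  shows "Phi_coeff \<phi> d g \<alpha> (rho_distr \<zeta> f) (\<mu> + l) =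
    chiD d l * cis (2 * pi * sigma_form l \<zeta>) * cis (- pi * sigma_form l \<mu>)
      * Phi_coeff \<phi> d g \<alpha> (rho_distr \<zeta> f) \<mu>"
proof -
  define h where "h = h_alpha g \<alpha>"
  \<comment> \<open>The phase in \<open>\<mu>\<close> is the conjugate of the one in
    \<open>stft_rho_translate\<close>, since the second transform enters the pairing
    conjugated.\<close>
  define c where "c = chiD d l * cis (2 * pi * sigma_form l \<zeta>) * cis (- pi * sigma_form l \<mu>)"
  define F where "F \<mu> z = stft \<phi> (rho_distr \<zeta> f) z * cnj (stft \<phi> (distr_of (rho \<mu> h)) z)" for \<mu> z
  have "F (\<mu> + l) (z + l) = c * F \<mu> z" for z
  proof -
    have "cis (- pi * sigma_form l z) * cis (pi * sigma_form l z) = 1"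
      by (simp add: cis_mult)
    then show ?thesis
      unfolding F_def c_def stft_invariant_translate [OF assms] stft_rho_translate [OF assms(1)]
      by (simp add: cis_cnj mult_ac)
  qed
  then have "(\<integral>z. F (\<mu> + l) z \<partial>lborel) = c * (\<integral>z. F \<mu> z \<partial>lborel)"
    using integral_lborel_translate [of "F (\<mu> + l)" l] by simp
  then show ?thesis
    unfolding Phi_coeff_def pairing_def c_def F_def h_def by simp
qed

theorem proposition7p1:
  fixes \<phi> :: "'n::{finite,linorder} cfun"
    and d :: "'n \<Rightarrow> nat"
    and g \<gamma> :: "'m::finite \<Rightarrow> 'n cfun"
    and \<alpha> :: "complex ^ 'm"
    and rep :: "'n ivec \<times> 'n ivec \<Rightarrow> 'n ivec \<times> 'n ivec"
    and f :: "'n distr"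
    and \<zeta> l :: "'n phase"
  assumes "\<phi> \<in> schwartz" and "\<phi> \<noteq> (\<lambda>_. 0)"
    and "elementary_divisors d"
    and "representatives d rep"
    and "\<And>j. g j \<in> M1 \<phi>"
    and "gabor_frame d g"
    and "canonical_dual d g \<gamma>"
    and "f \<in> invariant_space \<phi> d"
    and "l \<in> Lat d"
  shows "(v_alpha d g \<alpha> \<noteq> (\<lambda>_. 0) \<longrightarrow>
            block \<phi> d g \<alpha> rep \<zeta> l f = (\<lambda>q. s_char d l \<zeta> * block \<phi> d g \<alpha> rep \<zeta> 0 f q)) \<and>
         (\<forall>\<mu>\<in>adjLat d.
            Phi_coeff \<phi> d g \<alpha> (rho_distr \<zeta> f) (\<mu> + l) =
              chiD d l * cis (2 * pi * sigma_form l \<zeta>) * cis (- pi * sigma_form l \<mu>) *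
              Phi_coeff \<phi> d g \<alpha> (rho_distr \<zeta> f) \<mu>)"
proof (intro conjI impI ballI)
  note coeff = Phi_coeff_translate [OF assms(1,8,9), of g \<alpha> \<zeta>]
  show "Phi_coeff \<phi> d g \<alpha> (rho_distr \<zeta> f) (\<mu> + l) =
      chiD d l * cis (2 * pi * sigma_form l \<zeta>) * cis (- pi * sigma_form l \<mu>) *
      Phi_coeff \<phi> d g \<alpha> (rho_distr \<zeta> f) \<mu>" for \<mu>
    by (rule coeff)
  show "block \<phi> d g \<alpha> rep \<zeta> l f = (\<lambda>q. s_char d l \<zeta> * block \<phi> d g \<alpha> rep \<zeta> 0 f q)"
  proof
    fix q
    \<comment> \<open>The phase built into the blocks is exactly the inverse of the
      \<open>\<mu>\<close>-dependent factor at \<open>\<mu> = nu d rep q\<close>; this makes the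
      remaining scalar independent of \<open>q\<close>.\<close>
    have "cis (pi * sigma_form l (nu d rep q)) * cis (- pi * sigma_form l (nu d rep q)) = 1"
      by (simp add: cis_mult)
    then have "cis (pi * sigma_form l (nu d rep q)) *
        Phi_coeff \<phi> d g \<alpha> (rho_distr \<zeta> f) (l + nu d rep q)
      = s_char d l \<zeta> * Phi_coeff \<phi> d g \<alpha> (rho_distr \<zeta> f) (nu d rep q)"
      using coeff [of "nu d rep q"] by (simp add: s_char_def add.commute mult_ac)
    then show "block \<phi> d g \<alpha> rep \<zeta> l f q = s_char d l \<zeta> * block \<phi> d g \<alpha> rep \<zeta> 0 f q"
      \<comment> \<open>In the block at 0 the built-in phase is 1, and off \<open>KD d\<close> both
        sides vanish.\<close>
      by (simp add: block_def sigma_form_simps)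
  qed
qed

end
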